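(* Let $k\in\mathbb{Z}_{\geq 0}$ and consider the Diophantine equation \[x^2+y^4+z^4+ky^2z^2+2xy^2+2xz^2=(7+k)xy^2z^2. \qquad (\ast\ast)\] Every positive integer solution $(x,y,z)$ of $(\ast\ast)$ appears exactly once as a vertex of the tree $\mathbb{T}^{k}$ (defined in the context).
   Context: The tree $\mathbb{T}^{k}$ has triplets of positive integers as vertices and is built as follows. (1) The root vertex is $(1,1,1)$. (2) The root $(1,1,1)$ has exactly three children: $(k+2,1,1)$, $(1,2,1)$, $(1,1,2)$. (3) Every vertex $(a,b,c)$ other than the root has exactly two children, determined as follows: (i) if $a$ is the maximal number in $(a,b^2,c^2)$, the children are $\left(a,\frac{a+c^2}{b},c\right)$ and $\left(a,b,\frac{a+b^2}{c}\right)$; (ii) if $b^2$ is the maximal number in $(a,b^2,c^2)$, the children are $\left(\frac{b^4+kb^2c^2+c^4}{a},b,c\right)$ and $\left(a,b,\frac{a+b^2}{c}\right)$; (iii) if $c^2$ is the maximal number in $(a,b^2,c^2)$, the children are $\left(\frac{b^4+kb^2c^2+c^4}{a},b,c\right)$ and $\left(a,\frac{a+c^2}{b},c\right)$. *)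

theory Defs
  imports Main
begin

type_synonym triplet = "int \<times> int \<times> int"

definition root_children :: "int \<Rightarrow> triplet list" where
  "root_children k = [(k + 2, 1, 1), (1, 2, 1), (1, 1, 2)]"

text \<open>
  The operation \<open>div\<close> truncates and the case distinction fixes an order for ties, but neither
  matters inside the tree: the lemmas \<open>tree_solves\<close>, \<open>tree_div_exact\<close> and \<open>tree_max_unique\<close> below
  show that all vertices are triplets of positive integers, that the divisions at a vertex are exact,
  and that at a vertex other than the root the three cases are mutually exclusive.
\<close>

fun children :: "int \<Rightarrow> triplet \<Rightarrow> triplet list" where
  "children k (a, b, c) =
    (if a = Max {a, b^2, c^2} then
       [(a, (a + c^2) div b, c), (a, b, (a + b^2) div c)]
     else if b^2 = Max {a, b^2, c^2} then
       [((b^4 + k * b^2 * c^2 + c^4) div a, b, c), (a, b, (a + b^2) div c)]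
     else
       [((b^4 + k * b^2 * c^2 + c^4) div a, b, c), (a, (a + c^2) div b, c)])"

text \<open>
  \<open>vertex_at k p t\<close>: the vertex of the tree with address \<open>p\<close> carries the triplet \<open>t\<close>. An address
  lists the child positions chosen on the way down from the root, so that two vertices carrying
  the same triplet are still told apart, and the root is recognised by its address \<open>[]\<close> rather
  than by its triplet.
\<close>

inductive vertex_at :: "int \<Rightarrow> nat list \<Rightarrow> triplet \<Rightarrow> bool" for k :: int where
  root: "vertex_at k [] (1, 1, 1)"
| root_child: "i < length (root_children k) \<Longrightarrow> vertex_at k [i] (root_children k ! i)"
| child: "vertex_at k p t \<Longrightarrow> p \<noteq> [] \<Longrightarrow> i < length (children k t) \<Longrightarrow>
    vertex_at k (p @ [i]) (children k t ! i)"

definition solves :: "int \<Rightarrow> int \<Rightarrow> int \<Rightarrow> int \<Rightarrow> bool" where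
  "solves k x y z \<longleftrightarrow> x > 0 \<and> y > 0 \<and> z > 0 \<and>
     x^2 + y^4 + z^4 + k * y^2 * z^2 + 2 * x * y^2 + 2 * x * z^2 = (7 + k) * x * y^2 * z^2"

lemma solves_swap: "solves k x y z \<longleftrightarrow> solves k x z y"
  unfolding solves_def by (auto simp: algebra_simps)

lemma solves_mut_x:
  assumes "k \<ge> 0" "solves k x y z"
  shows "x dvd y^4 + k * y^2 * z^2 + z^4" "solves k ((y^4 + k * y^2 * z^2 + z^4) div x) y z"
proof -
  define w where "w = (7 + k) * y^2 * z^2 - 2 * y^2 - 2 * z^2 - x"
  have e: "y^4 + k * y^2 * z^2 + z^4 = x * w"
    using assms(2) unfolding solves_def w_def by (simp add: algebra_simps power2_eq_square)
  then show "x dvd y^4 + k * y^2 * z^2 + z^4" by simp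
  have pos: "x > 0" "y > 0" "z > 0" using assms(2) by (auto simp: solves_def)
  have "x * w > 0" unfolding e[symmetric] using pos assms(1)
    by (intro add_pos_pos add_pos_nonneg) auto
  then have w: "w > 0" using pos by (simp add: zero_less_mult_iff)
  have "w^2 + y^4 + z^4 + k * y^2 * z^2 + 2 * w * y^2 + 2 * w * z^2
      = w * (w + x + 2 * y^2 + 2 * z^2)"
    using e by (simp add: algebra_simps power2_eq_square)
  also have "\<dots> = (7 + k) * w * y^2 * z^2" by (simp add: w_def algebra_simps)
  finally show "solves k ((y^4 + k * y^2 * z^2 + z^4) div x) y z"
    using e pos w by (simp add: solves_def)
qed

lemma solves_mut_y:
  assumes "solves k x y z"
  shows "y dvd x + z^2" "solves k x ((x + z^2) div y) z"
proof -
  have pos: "x > 0" "y > 0" "z > 0" using assms by (auto simp: solves_def)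
  define u where "u = (7 + k) * x * z^2 - k * z^2 - 2 * x - y^2"
  have e: "(x + z^2)^2 = y^2 * u"
    using assms unfolding solves_def u_def by algebra
  then have "y^2 dvd (x + z^2)^2" by simp
  then show d: "y dvd x + z^2" by simp
  then obtain v where v: "x + z^2 = y * v" by blast
  have "x + z^2 > 0" using pos by (simp add: add_pos_pos)
  then have vpos: "v > 0" using v pos by (simp add: zero_less_mult_iff)
  have "y^2 * v^2 = y^2 * u" using e v by (simp add: power_mult_distrib)
  then have uv: "v^2 = u" using pos by simp
  have "x^2 + v^4 + z^4 + k * v^2 * z^2 + 2 * x * v^2 + 2 * x * z^2
      = (7 + k) * x * v^2 * z^2"
    using e uv unfolding u_def by algebra
  then show "solves k x ((x + z^2) div y) z"
    using v pos vpos by (simp add: solves_def)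
qed

lemma solves_mut_z:
  assumes "solves k x y z"
  shows "z dvd x + y^2" "solves k x y ((x + y^2) div z)"
  using solves_mut_y[of k x z y] assms by (auto simp: solves_swap)

lemma Max3: "Max {a, b, c::int} = max a (max b c)"
  by simp

lemma le_one_imp: "y > 0 \<Longrightarrow> y^2 \<le> (1::int) \<Longrightarrow> y = 1"
  by (metis abs_of_pos abs_square_le_1 int_one_le_iff_zero_less order_antisym)

lemma tree_solves:
  assumes "k \<ge> 0" "vertex_at k p t"
  shows "(case t of (a, b, c) \<Rightarrow> solves k a b c) \<and> (p \<noteq> [] \<longrightarrow> t \<noteq> (1, 1, 1))"
  using assms(2)
proof (induction rule: vertex_at.induct)
  case root
  show ?case by (simp add: solves_def)
next
  case (root_child i)
  then have "i = 0 \<or> i = 1 \<or> i = 2" by (auto simp: root_children_def)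
  then show ?case using assms(1)
    by (auto simp: root_children_def solves_def algebra_simps power2_eq_square)
next
  case (child p t i)
  obtain a b c where t: "t = (a, b, c)" by (cases t)
  have s: "solves k a b c" and n: "(a, b, c) \<noteq> (1, 1, 1)" using child t by auto
  have pos: "a > 0" "b > 0" "c > 0" using s by (auto simp: solves_def)
  have i: "i = 0 \<or> i = 1" using child t by (auto split: if_splits)
  note m = solves_mut_x[OF assms(1) s] solves_mut_y[OF s] solves_mut_z[OF s]
  have le: "a \<le> Max {a, b^2, c^2}" "b^2 \<le> Max {a, b^2, c^2}" "c^2 \<le> Max {a, b^2, c^2}"
    by auto
  have "Max {a, b^2, c^2} \<noteq> 1"
  proof
    assume "Max {a, b^2, c^2} = 1"
    then have "a = 1" "b = 1" "c = 1" using le pos le_one_imp by auto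
    then show False using n by simp
  qed
  moreover have "c^2 = Max {a, b^2, c^2}" if "a \<noteq> Max {a, b^2, c^2}" "b^2 \<noteq> Max {a, b^2, c^2}"
    using that unfolding Max3 by linarith
  ultimately have l: "a = Max {a, b^2, c^2} \<Longrightarrow> a \<noteq> 1" "b^2 = Max {a, b^2, c^2} \<Longrightarrow> b \<noteq> 1"
    "a \<noteq> Max {a, b^2, c^2} \<Longrightarrow> b^2 \<noteq> Max {a, b^2, c^2} \<Longrightarrow> c \<noteq> 1"
    by (metis one_power2)+
  show ?case unfolding t using i m l by (auto simp del: Max_insert)
qed

lemma tree_div_exact:
  assumes "k \<ge> 0" "vertex_at k p (a, b, c)"
  shows "a dvd b^4 + k * b^2 * c^2 + c^4" "b dvd a + c^2" "c dvd a + b^2"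
  using tree_solves[OF assms] solves_mut_x[OF assms(1)] solves_mut_y solves_mut_z by auto

lemma max_unique_xy:
  assumes "k \<ge> 0" "solves k x y z" "x = y^2" "z^2 \<le> y^2"
  shows "(x, y, z) = (1, 1, 1)"
proof -
  have pos: "y > 0" "z > 0" using assms by (auto simp: solves_def)
  define Y Z where "Y = y^2" and "Z = z^2"
  have YZ: "Y \<ge> 1" "Z \<ge> 1" "Z \<le> Y" using pos assms unfolding Y_def Z_def by auto
  have e: "4 * (Y * Y) * (Z - 1) + (k + 2) * (Y * Z) * (Y - 1) + Z * (Y * Y - Z) = 0"
    using assms(2,3) unfolding solves_def Y_def Z_def by algebra
  have "Z \<le> Y * Y" using YZ mult_mono[of 1 Y Z Y] by simp
  then have "4 * (Y * Y) * (Z - 1) \<ge> 0" "(k + 2) * (Y * Z) * (Y - 1) \<ge> 0" "Z * (Y * Y - Z) \<ge> 0"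
    using YZ assms(1) by auto
  with e have "4 * (Y * Y) * (Z - 1) = 0" "(k + 2) * (Y * Z) * (Y - 1) = 0" by linarith+
  then have "Z = 1" "Y = 1" using YZ assms(1) by auto
  then show ?thesis using pos assms(3) le_one_imp unfolding Y_def Z_def by auto
qed

lemma max_unique_yz:
  assumes "k \<ge> 0" "solves k x y z" "y^2 = z^2" "x \<le> y^2"
  shows "(x, y, z) = (1, 1, 1)"
proof -
  have pos: "x \<ge> 1" "y > 0" "z > 0" using assms by (auto simp: solves_def)
  define Y where "Y = y^2"
  have Y: "Y \<ge> 1" "x \<le> Y" using pos assms unfolding Y_def by auto
  have e: "x * (Y * Y - x) + (2 + k) * (Y * Y) * (x - 1) + 4 * (x * Y) * (Y - 1) = 0"
    using assms(2,3) unfolding solves_def Y_def by algebra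
  have "x \<le> Y * Y" using Y mult_mono[of 1 Y x Y] pos by simp
  then have "x * (Y * Y - x) \<ge> 0" "(2 + k) * (Y * Y) * (x - 1) \<ge> 0" "4 * (x * Y) * (Y - 1) \<ge> 0"
    using Y pos assms(1) by auto
  with e have "(2 + k) * (Y * Y) * (x - 1) = 0" "4 * (x * Y) * (Y - 1) = 0" by linarith+
  then have "x = 1" "Y = 1" using Y pos assms(1) by auto
  then show ?thesis using pos assms(3) le_one_imp unfolding Y_def by auto
qed

lemma tree_max_unique:
  assumes "k \<ge> 0" "vertex_at k p (a, b, c)" "p \<noteq> []"
  shows "\<not> (a = Max {a, b^2, c^2} \<and> b^2 = Max {a, b^2, c^2})"
    "\<not> (a = Max {a, b^2, c^2} \<and> c^2 = Max {a, b^2, c^2})"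
    "\<not> (b^2 = Max {a, b^2, c^2} \<and> c^2 = Max {a, b^2, c^2})"
proof -
  have s: "solves k a b c" and n: "(a, b, c) \<noteq> (1, 1, 1)"
    using tree_solves[OF assms(1,2)] assms(3) by auto
  have s': "solves k a c b" using s by (simp add: solves_swap)
  have le: "a \<le> Max {a, b^2, c^2}" "b^2 \<le> Max {a, b^2, c^2}" "c^2 \<le> Max {a, b^2, c^2}"
    by auto
  show "\<not> (a = Max {a, b^2, c^2} \<and> b^2 = Max {a, b^2, c^2})"
    using max_unique_xy[OF assms(1) s] n le by metis
  show "\<not> (a = Max {a, b^2, c^2} \<and> c^2 = Max {a, b^2, c^2})"
    using max_unique_xy[OF assms(1) s'] n le by (metis prod.inject)
  show "\<not> (b^2 = Max {a, b^2, c^2} \<and> c^2 = Max {a, b^2, c^2})"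
    using max_unique_yz[OF assms(1) s] n le by metis
qed

end

theory Submission
  imports Defs
begin

text \<open>
  Fixing two of the three weights \<open>x\<close>, \<open>y\<^sup>2\<close>, \<open>z\<^sup>2\<close>, the equation is a quadratic in the third, and its
  two roots lie on different sides of the maximum \<open>M\<close> of the two fixed weights: the quadratic is
  nonpositive at \<open>M\<close> and the product of its roots exceeds \<open>M\<^sup>2\<close>. So the Vieta involution at a weight that
  is not the strict maximum makes it the strict maximum, and vice versa. The children of a vertex,
  the root included, are therefore exactly its images under the involutions that increase the
  weight, and the parent is recovered by applying the involution at the strict maximum, which is
  unique and exists for every solution but \<open>(1, 1, 1)\<close>.
\<close>

section \<open>Set-up: involutions, strict maxima, inequalities for Vieta roots\<close>

definition mut_x :: "int \<Rightarrow> triplet \<Rightarrow> triplet" where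
  "mut_x k = (\<lambda>(a, b, c). ((b^4 + k * b^2 * c^2 + c^4) div a, b, c))"

definition mut_y :: "triplet \<Rightarrow> triplet" where
  "mut_y = (\<lambda>(a, b, c). (a, (a + c^2) div b, c))"

definition mut_z :: "triplet \<Rightarrow> triplet" where
  "mut_z = (\<lambda>(a, b, c). (a, b, (a + b^2) div c))"

definition solution :: "int \<Rightarrow> triplet \<Rightarrow> bool" where
  "solution k = (\<lambda>(a, b, c). solves k a b c)"

definition x_max :: "triplet \<Rightarrow> bool" where
  "x_max = (\<lambda>(a, b, c). b^2 < a \<and> c^2 < a)"

definition y_max :: "triplet \<Rightarrow> bool" where
  "y_max = (\<lambda>(a, b, c). a < b^2 \<and> c^2 < b^2)"

definition z_max :: "triplet \<Rightarrow> bool" where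
  "z_max = (\<lambda>(a, b, c). a < c^2 \<and> b^2 < c^2)"

text \<open>Treats the root like any other vertex. The order x, y, z is that of
  \<open>root_children\<close> and \<open>children\<close>, so child positions, and hence addresses,
  agree.\<close>

definition descendants :: "int \<Rightarrow> triplet \<Rightarrow> triplet list" where
  "descendants k t = (if x_max t then [] else [mut_x k t]) @
     (if y_max t then [] else [mut_y t]) @ (if z_max t then [] else [mut_z t])"

text \<open>On solutions other than (1, 1, 1) the last branch means \<open>z_max\<close>; at (1, 1,
  1) the value is a mere default.\<close>

definition parent :: "int \<Rightarrow> triplet \<Rightarrow> triplet" where
  "parent k t = (if x_max t then mut_x k t else if y_max t then mut_y t else mut_z t)"

text \<open>M and N stand for the larger and the smaller fixed weight; P and Q will be 4 and k + 2
  in either order, so that P + Q + 1 = 7 + k. Distributing this coefficient over the other three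
  terms leaves products of nonnegative factors, because N <= M <= M^2.\<close>

lemma vieta_value_nonpos:
  fixes P Q M N :: int
  assumes "P \<ge> 0" "Q \<ge> 0" "N \<ge> 1" "N \<le> M"
  shows "P * M^2 + Q * (M * N) + N^2 - (P + Q + 1) * (M^2 * N) \<le> 0"
proof -
  have "N \<le> M * M" using assms mult_mono[of 1 M N M] by simp
  then have "P * M^2 * (N - 1) \<ge> 0" "Q * (M * N) * (M - 1) \<ge> 0" "N * (M * M - N) \<ge> 0"
    using assms by auto
  moreover have "P * M^2 + Q * (M * N) + N^2 - (P + Q + 1) * (M^2 * N)
      = - (P * M^2 * (N - 1) + Q * (M * N) * (M - 1) + N * (M * M - N))"
    by algebra
  ultimately show ?thesis by linarith
qed

text \<open>If both roots exceeded M, the product of differences would be positive; if neither did,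
  u * v would be at most M^2.\<close>

lemma vieta_roots_straddle:
  fixes u v M :: int
  assumes "u > 0" "v > 0" "(M - u) * (M - v) \<le> 0" "u * v > M^2"
  shows "u > M \<longleftrightarrow> v \<le> M"
proof
  assume "u > M"
  show "v \<le> M"
  proof (rule ccontr)
    assume "\<not> v \<le> M"
    then have "(u - M) * (v - M) > 0" using \<open>u > M\<close> by simp
    then show False using assms(3) by (simp add: algebra_simps)
  qed
next
  assume "v \<le> M"
  show "u > M"
  proof (rule ccontr)
    assume "\<not> u > M"
    then have "u * v \<le> M * M" using \<open>v \<le> M\<close> assms by (intro mult_mono) auto
    then show False using assms(4) by (simp add: power2_eq_square)
  qed
qed

section \<open>Effect of the involutions on solutions and on the strict maximum\<close>

lemma solution_mut:
  assumes "k \<ge> 0" "solution k t"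
  shows "solution k (mut_x k t)" "solution k (mut_y t)" "solution k (mut_z t)"
  using assms(2) solves_mut_x(2)[OF assms(1)] solves_mut_y(2) solves_mut_z(2)
  by (auto simp: solution_def mut_x_def mut_y_def mut_z_def algebra_simps split: prod.splits)

lemma mut_x_involution:
  assumes "k \<ge> 0" "solution k t"
  shows "mut_x k (mut_x k t) = t"
proof -
  obtain a b c where t: "t = (a, b, c)" by (cases t)
  have s: "solves k a b c" using assms t by (simp add: solution_def)
  obtain w where w: "b^4 + k * b^2 * c^2 + c^4 = a * w"
    using solves_mut_x(1)[OF assms(1) s] by auto
  have "a > 0" using s by (simp add: solves_def)
  moreover have "w > 0" using solves_mut_x(2)[OF assms(1) s] w \<open>a > 0\<close> by (simp add: solves_def)
  ultimately show ?thesis by (simp add: t mut_x_def w)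
qed

lemma mut_y_involution:
  assumes "solution k t"
  shows "mut_y (mut_y t) = t"
proof -
  obtain a b c where t: "t = (a, b, c)" by (cases t)
  have s: "solves k a b c" using assms t by (simp add: solution_def)
  obtain v where v: "a + c^2 = b * v" using solves_mut_y(1)[OF s] by auto
  have "b > 0" using s by (simp add: solves_def)
  moreover have "v > 0" using solves_mut_y(2)[OF s] v \<open>b > 0\<close> by (simp add: solves_def)
  ultimately show ?thesis by (simp add: t mut_y_def v)
qed

lemma mut_z_involution:
  assumes "solution k t"
  shows "mut_z (mut_z t) = t"
proof -
  obtain a b c where t: "t = (a, b, c)" by (cases t)
  then have "solution k (a, c, b)" using assms by (simp add: solution_def solves_swap)
  then show ?thesis using mut_y_involution by (auto simp: t mut_z_def mut_y_def)
qed

lemma x_max_mut_x: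
  assumes "k \<ge> 0" "solution k t"
  shows "x_max (mut_x k t) \<longleftrightarrow> \<not> x_max t"
proof -
  obtain a b c where t: "t = (a, b, c)" by (cases t)
  have s: "solves k a b c" using assms t by (simp add: solution_def)
  obtain w where w: "b^4 + k * b^2 * c^2 + c^4 = a * w"
    using solves_mut_x(1)[OF assms(1) s] by auto
  have pos: "a > 0" "b > 0" "c > 0" using s by (auto simp: solves_def)
  have m: "mut_x k t = (w, b, c)" using pos by (simp add: t mut_x_def w)
  have wpos: "w > 0" using solution_mut(1)[OF assms] by (simp add: m solution_def solves_def)
  define B C where "B = b^2" and "C = c^2"
  have BC: "B \<ge> 1" "C \<ge> 1" using pos unfolding B_def C_def by auto
  have e: "a * w = B^2 + k * (B * C) + C^2"
    using w by (simp add: B_def C_def algebra_simps)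
  \<comment> \<open>The equation with its x-free terms replaced by a * w; cancelling a gives Vieta's
    sum of the roots.\<close>
  have "a * (a + w) = a * ((7 + k) * (B * C) - 2 * B - 2 * C)"
    using s e unfolding solves_def B_def C_def by algebra
  then have sm: "a + w = (7 + k) * (B * C) - 2 * B - 2 * C" using pos by simp
  \<comment> \<open>The monic quadratic in x, with roots a and w, evaluated at both fixed weights;
    the larger one is the M of the inequality.\<close>
  have "(B - a) * (B - w) = 4 * B^2 + (k + 2) * (B * C) + C^2 - (4 + (k + 2) + 1) * (B^2 * C)"
    using e sm by algebra
  moreover have "(C - a) * (C - w) = 4 * C^2 + (k + 2) * (C * B) + B^2 - (4 + (k + 2) + 1) * (C^2 * B)"
    using e sm by algebra
  ultimately have "(max B C - a) * (max B C - w) \<le> 0"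
    using vieta_value_nonpos[of 4 "k + 2" C B] vieta_value_nonpos[of 4 "k + 2" B C] BC assms(1)
    by (auto simp: max_def)
  moreover have "k * (B * C) \<ge> 0" "B^2 > 0" "C^2 > 0"
    using assms(1) BC by (simp_all add: zero_less_power)
  then have "a * w > (max B C)^2" using e
    by (cases B C rule: linorder_le_cases)
      (auto simp: max_absorb1 max_absorb2 add_pos_nonneg add_nonneg_pos)
  ultimately have "a > max B C \<longleftrightarrow> w \<le> max B C" using pos wpos by (intro vieta_roots_straddle)
  then show ?thesis unfolding m by (auto simp: t x_max_def B_def C_def)
qed

text \<open>The equation is quadratic in y^2, so the roots are b^2 and v^2; their product is the
  square (a + c^2)^2, matching b * v = a + c^2. The fixed weights a and c^2 enter asymmetrically, so
  4 and k + 2 swap roles between the two evaluations.\<close>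

lemma y_max_mut_y:
  assumes "k \<ge> 0" "solution k t"
  shows "y_max (mut_y t) \<longleftrightarrow> \<not> y_max t"
proof -
  obtain a b c where t: "t = (a, b, c)" by (cases t)
  have s: "solves k a b c" using assms t by (simp add: solution_def)
  obtain v where v: "a + c^2 = b * v" using solves_mut_y(1)[OF s] by auto
  have pos: "a > 0" "b > 0" "c > 0" using s by (auto simp: solves_def)
  have m: "mut_y t = (a, v, c)" using pos by (simp add: t mut_y_def v)
  have vpos: "v > 0" using solution_mut(2)[OF assms] by (simp add: m solution_def solves_def)
  define B C V where "B = b^2" and "C = c^2" and "V = v^2"
  have BC: "B \<ge> 1" "C \<ge> 1" "V \<ge> 1" using pos vpos unfolding B_def C_def V_def by auto
  have e: "B * V = (a + C)^2"
    using v by (simp add: B_def C_def V_def power_mult_distrib)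
  have "B * (B + V) = B * ((7 + k) * (a * C) - k * C - 2 * a)"
    using s e unfolding solves_def B_def C_def by algebra
  then have sm: "B + V = (7 + k) * (a * C) - k * C - 2 * a" using BC by simp
  have "(a - B) * (a - V) = 4 * a^2 + (k + 2) * (a * C) + C^2 - (4 + (k + 2) + 1) * (a^2 * C)"
    using e sm by algebra
  moreover have "(C - B) * (C - V) = (k + 2) * C^2 + 4 * (C * a) + a^2 - ((k + 2) + 4 + 1) * (C^2 * a)"
    using e sm by algebra
  ultimately have "(max a C - B) * (max a C - V) \<le> 0"
    using vieta_value_nonpos[of 4 "k + 2" C a] vieta_value_nonpos[of "k + 2" 4 a C]
      BC assms(1) pos
    by (auto simp: max_def)
  moreover have "B * V > (max a C)^2"
    unfolding e using pos BC by (intro power_strict_mono) auto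
  ultimately have "B > max a C \<longleftrightarrow> V \<le> max a C" using BC by (intro vieta_roots_straddle) auto
  then show ?thesis unfolding m by (auto simp: t y_max_def B_def C_def V_def)
qed

lemma z_max_mut_z:
  assumes "k \<ge> 0" "solution k t"
  shows "z_max (mut_z t) \<longleftrightarrow> \<not> z_max t"
proof -
  obtain a b c where t: "t = (a, b, c)" by (cases t)
  then have "solution k (a, c, b)" using assms by (simp add: solution_def solves_swap)
  from y_max_mut_y[OF assms(1) this] show ?thesis
    by (auto simp: t mut_z_def mut_y_def z_max_def y_max_def)
qed

section \<open>The tree described through strict maxima\<close>

lemma strict_max_unique:
  "x_max t \<Longrightarrow> \<not> y_max t" "x_max t \<Longrightarrow> \<not> z_max t" "y_max t \<Longrightarrow> \<not> z_max t"
  by (auto simp: x_max_def y_max_def z_max_def)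

text \<open>Otherwise the maximum is attained twice, which forces (1, 1, 1). A tie of x with z^2
  reduces to one with y^2 by swapping y and z.\<close>

lemma strict_max_exists:
  assumes "k \<ge> 0" "solution k t" "t \<noteq> (1, 1, 1)"
  shows "x_max t \<or> y_max t \<or> z_max t"
proof -
  obtain a b c where t: "t = (a, b, c)" by (cases t)
  have s: "solves k a b c" "solves k a c b" and n: "(a, b, c) \<noteq> (1, 1, 1)" "(a, c, b) \<noteq> (1, 1, 1)"
    using assms t by (auto simp: solution_def solves_swap)
  show ?thesis
    using max_unique_xy[OF assms(1) s(1)] max_unique_xy[OF assms(1) s(2)]
      max_unique_yz[OF assms(1) s(1)] n
    unfolding t x_max_def y_max_def z_max_def prod.case by linarith
qed

lemma not_max_root: "\<not> x_max (1, 1, 1)" "\<not> y_max (1, 1, 1)" "\<not> z_max (1, 1, 1)"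
  by (simp_all add: x_max_def y_max_def z_max_def)

lemma descendants_root: "descendants k (1, 1, 1) = root_children k"
  by (simp add: descendants_def root_children_def not_max_root mut_x_def mut_y_def mut_z_def)

lemma descendants_not_root:
  assumes "k \<ge> 0" "solution k t" "t \<noteq> (1, 1, 1)"
  shows "descendants k t = children k t"
proof -
  obtain a b c where t: "t = (a, b, c)" by (cases t)
  show ?thesis
    using strict_max_exists[OF assms]
    by (auto simp: t descendants_def x_max_def y_max_def z_max_def mut_x_def mut_y_def mut_z_def
        max_def)
qed

lemma vertex_at_solution:
  assumes "k \<ge> 0" "vertex_at k p t"
  shows "solution k t" "t = (1, 1, 1) \<Longrightarrow> p = []"
  using tree_solves[OF assms] by (auto simp: solution_def)

text \<open>Merges the rules for root children and other children into one recursion on the last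
  letter of the address.\<close>

lemma vertex_at_snoc_iff:
  assumes "k \<ge> 0"
  shows "vertex_at k (p @ [i]) t \<longleftrightarrow>
    (\<exists>s. vertex_at k p s \<and> i < length (descendants k s) \<and> t = descendants k s ! i)"
proof
  assume "vertex_at k (p @ [i]) t"
  then show "\<exists>s. vertex_at k p s \<and> i < length (descendants k s) \<and> t = descendants k s ! i"
  proof cases
    case root_child
    then show ?thesis
      using vertex_at.root by (intro exI[of _ "(1, 1, 1)"]) (auto simp: descendants_root)
  next
    case (child q s j)
    then have "descendants k s = children k s"
      using vertex_at_solution[OF assms] by (intro descendants_not_root[OF assms]) blast+
    then show ?thesis using child by (intro exI[of _ s]) auto
  qed simp
next
  assume "\<exists>s. vertex_at k p s \<and> i < length (descendants k s) \<and> t = descendants k s ! i"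
  then obtain s where s: "vertex_at k p s" "i < length (descendants k s)" "t = descendants k s ! i"
    by auto
  show "vertex_at k (p @ [i]) t"
  proof (cases "s = (1, 1, 1)")
    case True
    \<comment> \<open>Only the address \<open>[]\<close> carries (1, 1, 1), so the rule for root
      children applies.\<close>
    then show ?thesis
      using s vertex_at.root_child vertex_at_solution(2)[OF assms s(1)] by (auto simp: descendants_root)
  next
    case False
    moreover have "p \<noteq> []"
      using s(1) False by (auto elim: vertex_at.cases)
    ultimately show ?thesis
      using s descendants_not_root[OF assms vertex_at_solution(1)[OF assms s(1)]]
      by (auto intro: vertex_at.child)
  qed
qed

section \<open>Uniqueness of the address\<close>

lemma parent_descendant:
  assumes "k \<ge> 0" "solution k t" "s \<in> set (descendants k t)"
  shows "parent k s = t"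
  \<comment> \<open>The involution that produced s acted where t has no strict maximum, so s has its
    only strict maximum there; \<open>parent\<close> picks the same involution and undoes
    it.\<close>
  using assms(3) x_max_mut_x[OF assms(1,2)] y_max_mut_y[OF assms(1,2)] z_max_mut_z[OF assms(1,2)]
    mut_x_involution[OF assms(1,2)] mut_y_involution[OF assms(2)] mut_z_involution[OF assms(2)]
    strict_max_unique[of s]
  by (auto simp: descendants_def parent_def split: if_splits)

text \<open>Different descendants have their strict maximum at different positions.\<close>

lemma distinct_descendants:
  assumes "k \<ge> 0" "solution k t"
  shows "distinct (descendants k t)"
  using x_max_mut_x[OF assms] y_max_mut_y[OF assms] z_max_mut_z[OF assms]
    strict_max_unique[of "mut_x k t"] strict_max_unique[of "mut_y t"]
  by (auto simp: descendants_def)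

text \<open>The triplet determines its parent, and distinctness of the siblings determines the last
  letter.\<close>

lemma vertex_at_unique:
  assumes "k \<ge> 0" "vertex_at k p t" "vertex_at k q t"
  shows "p = q"
  using assms(2,3)
proof (induction p arbitrary: q t rule: rev_induct)
  case Nil
  then have "t = (1, 1, 1)" by (auto elim: vertex_at.cases)
  then show ?case using vertex_at_solution(2)[OF assms(1) Nil(2)] by simp
next
  case (snoc i p)
  obtain s where s: "vertex_at k p s" "i < length (descendants k s)" "t = descendants k s ! i"
    using snoc.prems(1) vertex_at_snoc_iff[OF assms(1)] by auto
  have "q \<noteq> []"
  proof
    assume "q = []"
    then have "t = (1, 1, 1)" using snoc.prems(2) by (auto elim: vertex_at.cases)
    then show False using vertex_at_solution(2)[OF assms(1) snoc.prems(1)] by simp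
  qed
  then obtain q' j where q: "q = q' @ [j]" by (cases q rule: rev_cases) auto
  obtain s' where s': "vertex_at k q' s'" "j < length (descendants k s')" "t = descendants k s' ! j"
    using snoc.prems(2) vertex_at_snoc_iff[OF assms(1)] q by auto
  have "parent k t = s" "parent k t = s'"
    using parent_descendant[OF assms(1)] vertex_at_solution(1)[OF assms(1)] s s' nth_mem by metis+
  then have "s' = s" by simp
  moreover have "j = i"
    using distinct_descendants[OF assms(1) vertex_at_solution(1)[OF assms(1) s(1)]] s s' \<open>s' = s\<close>
    by (simp add: nth_eq_iff_index_eq)
  ultimately show ?case using snoc.IH[OF s(1)] s'(1) q by simp
qed

section \<open>Descent from an arbitrary solution to the root\<close>

lemma descendant_parent:
  assumes "k \<ge> 0" "solution k t" "t \<noteq> (1, 1, 1)"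
  shows "solution k (parent k t)" "t \<in> set (descendants k (parent k t))"
  using strict_max_exists[OF assms] solution_mut[OF assms(1,2)]
    x_max_mut_x[OF assms(1,2)] y_max_mut_y[OF assms(1,2)] z_max_mut_z[OF assms(1,2)]
    mut_x_involution[OF assms(1,2)] mut_y_involution[OF assms(2)] mut_z_involution[OF assms(2)]
  by (auto simp: parent_def descendants_def)

definition height :: "triplet \<Rightarrow> nat" where
  "height = (\<lambda>(a, b, c). nat (a + b^2 + c^2))"

text \<open>The strictly maximal weight drops to at most the larger of the other two, which stay
  fixed.\<close>

lemma height_parent_less:
  assumes "k \<ge> 0" "solution k t" "t \<noteq> (1, 1, 1)"
  shows "height (parent k t) < height t"
proof -
  obtain a b c where t: "t = (a, b, c)" by (cases t)
  have pos: "a > 0" using assms by (auto simp: t solution_def solves_def)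
  \<comment> \<open>\<open>nat\<close> preserves a strict inequality only if the larger side is
    positive.\<close>
  have "a + b^2 + c^2 > 0" using pos by (simp add: add_pos_nonneg)
  then show ?thesis
    using strict_max_exists[OF assms]
      x_max_mut_x[OF assms(1,2)] y_max_mut_y[OF assms(1,2)] z_max_mut_z[OF assms(1,2)]
    by (auto simp: t parent_def height_def x_max_def y_max_def z_max_def
        mut_x_def mut_y_def mut_z_def)
qed

lemma solution_vertex:
  assumes "k \<ge> 0" "solution k t"
  shows "\<exists>p. vertex_at k p t"
  using assms(2)
proof (induction t rule: measure_induct_rule[of height])
  case (less t)
  show ?case
  proof (cases "t = (1, 1, 1)")
    case True
    then show ?thesis using vertex_at.root by auto
  next
    case False
    note d = descendant_parent[OF assms(1) less.prems False]
    obtain p where "vertex_at k p (parent k t)"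
      using less.IH height_parent_less[OF assms(1) less.prems False] d(1) by blast
    moreover obtain i where "i < length (descendants k (parent k t))"
        "t = descendants k (parent k t) ! i"
      using d(2) by (metis in_set_conv_nth)
    ultimately have "vertex_at k (p @ [i]) t" using vertex_at_snoc_iff[OF assms(1)] by blast
    then show ?thesis by blast
  qed
qed

theorem theorem1p2:
  fixes k x y z :: int
  assumes "k \<ge> 0"
    and "x > 0" and "y > 0" and "z > 0"
    and "x^2 + y^4 + z^4 + k * y^2 * z^2 + 2 * x * y^2 + 2 * x * z^2 = (7 + k) * x * y^2 * z^2"
  shows "\<exists>!p. vertex_at k p (x, y, z)"
proof -
  have "solution k (x, y, z)" using assms by (simp add: solution_def solves_def)
  then show ?thesis
    using solution_vertex[OF assms(1)] vertex_at_unique[OF assms(1)] by blast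
qed

end
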